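(* Let $n\ge 5$, $q>5$, and let $u\in C^{6}(\mathbb{R}^{n})$, $u>0$, be a radially symmetric solution of $\Delta^{3}u=u^{-q}$ in $\mathbb{R}^{n}$ such that $\liminf_{|x|\to+\infty}u(x)/|x|\in(0,+\infty]$ and $\lim_{r\to+\infty}u''(r)=\rho\in\mathbb{R}$ exists. Then $\rho\ge 0$. If $\rho>0$, then $\lim_{|x|\to+\infty}u(x)/|x|^{2}=\rho/2$. If $\rho=0$, then $$\lim_{|x|\to+\infty}\frac{u(x)}{|x|}=-\frac{1}{n-1}\int_{0}^{+\infty}t^{2}\Big(\Delta^{2}\bar u(t)-\frac{n-3}{t}(\Delta\bar u)'(t)\Big)dt\in(0,+\infty).$$
   Context: $u(r)$ denotes $u(x)$ with $r=|x|$; $\bar u(r)$ is the spherical average of $u$ over $\partial B_r(0)$ (equal to $u(r)$ here), and $\Delta\bar u$, $\Delta^{2}\bar u$ are the radial Laplacians, $\Delta f(r)=r^{1-n}(r^{n-1}f'(r))'$. *)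

theory Defs
  imports "HOL-Analysis.Analysis"
begin

fun Ck :: "nat \<Rightarrow> ('a::euclidean_space \<Rightarrow> real) \<Rightarrow> bool" where
  "Ck 0 f = continuous_on UNIV f"
| "Ck (Suc k) f = (f differentiable_on UNIV \<and>
      (\<forall>i\<in>Basis. Ck k (\<lambda>x. frechet_derivative f (at x) i)))"

definition partial :: "('a::euclidean_space \<Rightarrow> real) \<Rightarrow> 'a \<Rightarrow> 'a \<Rightarrow> real" where
  "partial f i x = frechet_derivative f (at x) i"

definition laplacian :: "('a::euclidean_space \<Rightarrow> real) \<Rightarrow> 'a \<Rightarrow> real" where
  "laplacian f x = (\<Sum>i\<in>Basis. partial (partial f i) i x)"

definition radial_profile :: "('a::euclidean_space \<Rightarrow> real) \<Rightarrow> real \<Rightarrow> real" where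
  "radial_profile u r = u (r *\<^sub>R (SOME b. b \<in> (Basis::'a set)))"

definition radial_lap :: "nat \<Rightarrow> (real \<Rightarrow> real) \<Rightarrow> real \<Rightarrow> real" where
  "radial_lap n f r = r powr (1 - real n) * deriv (\<lambda>s. s ^ (n - 1) * deriv f s) r"

end

theory Submission
  imports Defs "HOL-Real_Asymp.Real_Asymp"
begin

text \<open>
  Let \<open>f\<close> be the radial profile and \<open>a = n - 1\<close>. Since the radial Laplacian is
  \<open>\<Delta>h = r^(-a) (r^a h')'\<close>, the equation for \<open>v = \<Delta>f\<close> and \<open>w = \<Delta>v\<close> becomes the chain of flux
  identities \<open>(r^a f')' = r^a v\<close>, \<open>(r^a v')' = r^a w\<close>, \<open>(r^a w')' = r^a f^(-q)\<close>.
  Two applications of L'Hopital's rule give \<open>f/r^2 \<longrightarrow> \<rho>/2\<close>, hence \<open>\<rho> \<ge> 0\<close> and the case \<open>\<rho> > 0\<close>.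
  If \<open>\<rho> = 0\<close>, then \<open>v \<longrightarrow> 0\<close>. The growth \<open>f \<ge> c r\<close> and \<open>q > 5\<close> make \<open>r^4 w'\<close> converge to
  some \<open>K\<close>, so \<open>w\<close> converges, and its limit vanishes since otherwise \<open>v\<close> would grow like \<open>r^2\<close>.
  Integrating the flux identities back by L'Hopital's rule gives in turn \<open>r^3 w \<longrightarrow> -K/3\<close>,
  \<open>r^2 v' \<longrightarrow> I\<close>, \<open>r v \<longrightarrow> -I\<close>, \<open>f' \<longrightarrow> -I/a\<close> and \<open>f/r \<longrightarrow> -I/a\<close>, and \<open>-I/a \<ge> c > 0\<close>.
  The integrand of the theorem is \<open>(t^2 v')'\<close>, and \<open>t^2 v'\<close> vanishes at the origin because
  \<open>f'(0) = 0\<close>, so its integral is \<open>I\<close>.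
\<close>

lemma lhopital_at_top_0:
  fixes f g :: "real \<Rightarrow> real"
  assumes f0: "(f \<longlongrightarrow> 0) at_top" and g0: "(g \<longlongrightarrow> 0) at_top"
    and gnz: "eventually (\<lambda>x. g x \<noteq> 0) at_top"
    and g': "eventually (\<lambda>x. g' x \<noteq> 0) at_top"
    and Df: "eventually (\<lambda>x. DERIV f x :> f' x) at_top"
    and Dg: "eventually (\<lambda>x. DERIV g x :> g' x) at_top"
    and lim: "((\<lambda> x. (f' x / g' x)) \<longlongrightarrow> y) at_top"
  shows "((\<lambda> x. f x / g x) \<longlongrightarrow> y) at_top"
  unfolding filterlim_at_top_to_right
proof (rule lhopital_right_0)
  let ?F = "\<lambda>x. f (inverse x)"
  let ?G = "\<lambda>x. g (inverse x)"
  let ?R = "at_right (0::real)"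
  let ?D = "\<lambda>f' x. f' (inverse x) * - (inverse x ^ Suc (Suc 0))"
  show "(?F \<longlongrightarrow> 0) ?R" using f0 unfolding filterlim_at_top_to_right .
  show "(?G \<longlongrightarrow> 0) ?R" using g0 unfolding filterlim_at_top_to_right .
  show "eventually (\<lambda>x. ?G x \<noteq> 0) ?R"
    unfolding eventually_at_right_to_top using gnz by simp
  show "eventually (\<lambda>x. DERIV ?G x :> ?D g' x) ?R"
    unfolding eventually_at_right_to_top
    using Dg eventually_ge_at_top[where c=1]
    by eventually_elim (rule derivative_eq_intros DERIV_chain'[where f=inverse] | simp)+
  show "eventually (\<lambda>x. DERIV ?F x :> ?D f' x) ?R"
    unfolding eventually_at_right_to_top
    using Df eventually_ge_at_top[where c=1]
    by eventually_elim (rule derivative_eq_intros DERIV_chain'[where f=inverse] | simp)+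
  show "eventually (\<lambda>x. ?D g' x \<noteq> 0) ?R"
    unfolding eventually_at_right_to_top
    using g' eventually_ge_at_top[where c=1]
    by eventually_elim auto
  show "((\<lambda>x. ?D f' x / ?D g' x) \<longlongrightarrow> y) ?R"
    unfolding filterlim_at_right_to_top
    apply (intro filterlim_cong[THEN iffD2, OF refl refl _ lim])
    using eventually_ge_at_top[where c=1]
    by eventually_elim simp
qed

lemma tendsto_at_top_transform_pos:
  fixes f g :: "real \<Rightarrow> 'b::topological_space"
  assumes "(f \<longlongrightarrow> l) at_top" and "\<And>r. r > 0 \<Longrightarrow> f r = g r"
  shows "(g \<longlongrightarrow> l) at_top"
proof -
  have "\<forall>\<^sub>F r in at_top. f r = g r"
    using eventually_gt_at_top[of 0] by eventually_elim (rule assms(2))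
  with assms(1) show ?thesis by (rule Lim_transform_eventually)
qed

lemma powr_mult_power: "r > 0 \<Longrightarrow> r powr s * r ^ k = r powr (s + real k)"
  by (simp add: powr_add powr_realpow)

lemma tendsto_powr_mult_of_deriv:
  fixes F D :: "real \<Rightarrow> real" and p y :: real
  assumes p: "p \<noteq> 0" and F0: "p < 0 \<Longrightarrow> (F \<longlongrightarrow> 0) at_top"
    and DF: "\<forall>\<^sub>F r in at_top. (F has_real_derivative D r) (at r)"
    and lim: "((\<lambda>r. r powr (1 - p) * D r) \<longlongrightarrow> y) at_top"
  shows "((\<lambda>r. r powr (- p) * F r) \<longlongrightarrow> y / p) at_top"
proof -
  have pos: "\<forall>\<^sub>F r in at_top. r > (0::real)" by (rule eventually_gt_at_top)
  have Dg: "\<forall>\<^sub>F r in at_top. ((\<lambda>r. r powr p) has_real_derivative p * r powr (p - 1)) (at r)"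
    using pos by eventually_elim (rule has_real_derivative_powr)
  have g'nz: "\<forall>\<^sub>F r in at_top. p * r powr (p - 1) \<noteq> 0"
    using pos by eventually_elim (use p in simp)
  have quot: "((\<lambda>r. D r / (p * r powr (p - 1))) \<longlongrightarrow> y / p) at_top"
  proof (rule Lim_transform_eventually[OF tendsto_divide[OF lim tendsto_const[of p]]])
    show "\<forall>\<^sub>F r in at_top. r powr (1 - p) * D r / p = D r / (p * r powr (p - 1))"
      using pos by eventually_elim (use p in \<open>simp add: powr_diff powr_minus field_simps\<close>)
  qed (use p in simp)
  have "((\<lambda>r. F r / r powr p) \<longlongrightarrow> y / p) at_top"
  proof (cases "p > 0")
    case True
    have "LIM r at_top. r powr p :> at_top" using True by real_asymp
    then show ?thesis by (rule lhospital_at_top_at_top[OF _ g'nz DF Dg quot])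
  next
    case False
    then have "p < 0" using p by simp
    have "((\<lambda>r. r powr p) \<longlongrightarrow> 0) at_top" using \<open>p < 0\<close> by real_asymp
    moreover have "\<forall>\<^sub>F r in at_top. r powr p \<noteq> 0" using pos by eventually_elim simp
    ultimately show ?thesis
      by (rule lhopital_at_top_0[OF F0[OF \<open>p < 0\<close>] _ _ g'nz DF Dg quot])
  qed
  then show ?thesis by (simp add: powr_minus divide_inverse mult.commute)
qed

lemma tendsto_div_square_of_second_deriv:
  fixes f f1 f2 :: "real \<Rightarrow> real"
  assumes df: "\<And>r. (f has_real_derivative f1 r) (at r)"
    and df1: "\<And>r. (f1 has_real_derivative f2 r) (at r)"
    and lim: "(f2 \<longlongrightarrow> \<rho>) at_top"
  shows "((\<lambda>r. f r / r\<^sup>2) \<longlongrightarrow> \<rho> / 2) at_top"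
proof -
  have "((\<lambda>r. r powr (1 - 1) * f2 r) \<longlongrightarrow> \<rho>) at_top"
    by (rule tendsto_at_top_transform_pos[OF lim]) simp
  then have "((\<lambda>r. r powr (- 1) * f1 r) \<longlongrightarrow> \<rho> / 1) at_top"
    by (rule tendsto_powr_mult_of_deriv[rotated 3]) (simp_all add: df1 always_eventually)
  then have "((\<lambda>r. r powr (1 - 2) * f1 r) \<longlongrightarrow> \<rho>) at_top" by simp
  then have "((\<lambda>r. r powr (- 2) * f r) \<longlongrightarrow> \<rho> / 2) at_top"
    by (rule tendsto_powr_mult_of_deriv[rotated 3]) (simp_all add: df always_eventually)
  then show ?thesis
    by (rule tendsto_at_top_transform_pos) (simp add: powr_minus divide_inverse mult.commute)
qed

lemma mono_on_bounded_convergent_at_top: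
  fixes \<psi> :: "real \<Rightarrow> real"
  assumes mono: "mono_on {R..} \<psi>" and bdd: "\<And>r. r \<ge> R \<Longrightarrow> \<psi> r \<le> B"
  shows "\<exists>L. (\<psi> \<longlongrightarrow> L) at_top"
proof -
  define L where "L = Sup (\<psi> ` {R..})"
  have ba: "bdd_above (\<psi> ` {R..})" using bdd by (auto intro!: bdd_aboveI)
  have "(\<psi> \<longlongrightarrow> L) at_top"
  proof (rule increasing_tendsto)
    show "\<forall>\<^sub>F r in at_top. \<psi> r \<le> L"
      using eventually_ge_at_top[of R]
      by eventually_elim (auto simp: L_def intro!: cSup_upper ba)
    fix x assume "x < L"
    then obtain s where s: "s \<ge> R" "x < \<psi> s"
      unfolding L_def by (subst (asm) less_cSup_iff) (use ba in auto)
    show "\<forall>\<^sub>F r in at_top. x < \<psi> r"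
      using eventually_ge_at_top[of s]
    proof eventually_elim
      case (elim r)
      then have "\<psi> s \<le> \<psi> r" using s by (intro mono_onD[OF mono]) auto
      then show ?case using s by simp
    qed
  qed
  then show ?thesis by blast
qed

lemma convergent_at_top_of_deriv_bound:
  fixes \<phi> \<phi>' :: "real \<Rightarrow> real"
  assumes p: "p > 1"
    and bound: "\<forall>\<^sub>F r in at_top. (\<phi> has_real_derivative \<phi>' r) (at r) \<and> \<bar>\<phi>' r\<bar> \<le> M * r powr (- p)"
  shows "\<exists>L. (\<phi> \<longlongrightarrow> L) at_top"
proof -
  obtain R0 where R0: "\<And>r. r \<ge> R0 \<Longrightarrow> (\<phi> has_real_derivative \<phi>' r) (at r) \<and> \<bar>\<phi>' r\<bar> \<le> M * r powr (- p)"
    using bound unfolding eventually_at_top_linorder by blast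
  define R where "R = max R0 1"
  have R: "R \<ge> R0" "R > 0" unfolding R_def by auto
  have M: "M \<ge> 0"
    using R0[OF R(1)] R(2) by (smt (verit) powr_gt_zero zero_le_mult_iff)
  text \<open>\<open>E\<close> is an antiderivative of \<open>-M r powr (-p)\<close>, so \<open>\<phi> - E\<close> increases and \<open>\<phi> + E\<close> decreases.\<close>
  define E where "E r = M / (p - 1) * r powr (1 - p)" for r
  have dE: "(E has_real_derivative - M * r powr (- p)) (at r)" if "r > 0" for r
  proof -
    have "(E has_real_derivative M / (p - 1) * ((1 - p) * r powr (1 - p - 1))) (at r)"
      unfolding E_def by (intro DERIV_cmult has_real_derivative_powr that)
    moreover have "M / (p - 1) * ((1 - p) * r powr (1 - p - 1)) = - M * r powr (- p)"
      using p by (simp add: field_simps)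
    ultimately show ?thesis by simp
  qed
  have E_nonneg: "E r \<ge> 0" for r unfolding E_def using M p by simp
  have inc: "\<phi> r - E r \<le> \<phi> s - E s" if "R \<le> r" "r \<le> s" for r s
  proof (rule DERIV_nonneg_imp_nondecreasing[OF that(2)])
    fix x assume "r \<le> x" "x \<le> s"
    with that R have x: "x \<ge> R0" "x > 0" by auto
    show "\<exists>y. ((\<lambda>x. \<phi> x - E x) has_real_derivative y) (at x) \<and> 0 \<le> y"
      using R0[OF x(1)] DERIV_diff[OF _ dE[OF x(2)], of \<phi> "\<phi>' x"]
      by (intro exI[of _ "\<phi>' x - - M * x powr (- p)"]) auto
  qed
  have dec: "\<phi> s + E s \<le> \<phi> r + E r" if "R \<le> r" "r \<le> s" for r s
  proof (rule DERIV_nonpos_imp_nonincreasing[OF that(2)])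
    fix x assume "r \<le> x" "x \<le> s"
    with that R have x: "x \<ge> R0" "x > 0" by auto
    show "\<exists>y. ((\<lambda>x. \<phi> x + E x) has_real_derivative y) (at x) \<and> y \<le> 0"
      using R0[OF x(1)] DERIV_add[OF _ dE[OF x(2)], of \<phi> "\<phi>' x"]
      by (intro exI[of _ "\<phi>' x + - M * x powr (- p)"]) auto
  qed
  have "\<exists>L. ((\<lambda>r. \<phi> r - E r) \<longlongrightarrow> L) at_top"
  proof (rule mono_on_bounded_convergent_at_top)
    show "mono_on {R..} (\<lambda>r. \<phi> r - E r)" by (rule mono_onI) (use inc in auto)
    show "\<phi> r - E r \<le> \<phi> R + E R" if "r \<ge> R" for r
      using dec[OF order_refl that] E_nonneg[of r] by linarith
  qed
  then obtain L where L: "((\<lambda>r. \<phi> r - E r) \<longlongrightarrow> L) at_top" by blast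
  have "(E \<longlongrightarrow> 0) at_top" unfolding E_def using p by real_asymp
  from tendsto_add[OF L this] show ?thesis by auto
qed

lemma has_real_derivative_power_mult:
  fixes h :: "real \<Rightarrow> real"
  assumes "(h has_real_derivative h') (at r)" and "r > 0"
  shows "((\<lambda>s. s ^ k * h s) has_real_derivative r ^ k * (h' + real k * h r / r)) (at r)"
proof -
  have "((\<lambda>s. s ^ k * h s) has_real_derivative real k * r ^ (k - 1) * h r + r ^ k * h') (at r)"
    by (rule derivative_eq_intros assms(1) refl)+ simp
  moreover have "real k * r ^ (k - 1) * h r = r ^ k * (real k * h r / r)"
    using assms(2) by (cases k) (auto simp: field_simps)
  ultimately show ?thesis by (simp add: algebra_simps)
qed

lemma flux_tendsto:
  fixes h g :: "real \<Rightarrow> real" and a :: nat and s y :: real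
  assumes s: "s < real a"
    and flux: "\<And>r. r > 0 \<Longrightarrow> ((\<lambda>r. r ^ a * h r) has_real_derivative r ^ a * g r) (at r)"
    and lim: "((\<lambda>r. r powr (s + 1) * g r) \<longlongrightarrow> y) at_top"
  shows "((\<lambda>r. r powr s * h r) \<longlongrightarrow> y / (real a - s)) at_top"
proof -
  have "((\<lambda>r. r powr (- (real a - s)) * (r ^ a * h r)) \<longlongrightarrow> y / (real a - s)) at_top"
  proof (rule tendsto_powr_mult_of_deriv)
    show "\<forall>\<^sub>F r in at_top. ((\<lambda>r. r ^ a * h r) has_real_derivative r ^ a * g r) (at r)"
      using eventually_gt_at_top[of 0] by eventually_elim (rule flux)
    show "((\<lambda>r. r powr (1 - (real a - s)) * (r ^ a * g r)) \<longlongrightarrow> y) at_top"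
    proof (rule tendsto_at_top_transform_pos[OF lim])
      fix r :: real assume "r > 0"
      from powr_mult_power[OF this, of "1 - (real a - s)" a]
      show "r powr (s + 1) * g r = r powr (1 - (real a - s)) * (r ^ a * g r)"
        by (simp add: mult.assoc[symmetric] add.commute[of s])
    qed
  qed (use s in auto)
  then show ?thesis
  proof (rule tendsto_at_top_transform_pos)
    fix r :: real assume "r > 0"
    from powr_mult_power[OF this, of "- (real a - s)" a]
    show "r powr (- (real a - s)) * (r ^ a * h r) = r powr s * h r"
      by (simp add: mult.assoc[symmetric])
  qed
qed

lemma r4_flux_convergent:
  fixes w1 f :: "real \<Rightarrow> real" and a :: nat
  assumes a: "a \<ge> 4" and q: "q > 5" and c: "c > 0"
    and flux: "\<And>r. r > 0 \<Longrightarrow> ((\<lambda>r. r ^ a * w1 r) has_real_derivative r ^ a * f r powr (- q)) (at r)"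
    and grow: "\<forall>\<^sub>F r in at_top. c * r \<le> f r"
  shows "\<exists>K. ((\<lambda>r. r ^ 4 * w1 r) \<longlongrightarrow> K) at_top"
proof -
  define C where "C = c powr (- q)"
  have decay: "\<forall>\<^sub>F r in at_top. 0 \<le> f r powr (- q) \<and> f r powr (- q) \<le> C * r powr (- q)"
    using grow eventually_gt_at_top[of 0]
  proof eventually_elim
    case (elim r)
    have "f r powr (- q) \<le> (c * r) powr (- q)"
      by (rule powr_mono2') (use q c elim in auto)
    then show ?case using c elim by (simp add: C_def powr_mult)
  qed
  show ?thesis
  proof (cases "a = 4")
    case True
    show ?thesis
    proof (rule convergent_at_top_of_deriv_bound[of "q - 4" _ "\<lambda>r. r ^ 4 * f r powr (- q)" C])
      show "\<forall>\<^sub>F r in at_top. ((\<lambda>r. r ^ 4 * w1 r) has_real_derivative r ^ 4 * f r powr (- q)) (at r)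
          \<and> \<bar>r ^ 4 * f r powr (- q)\<bar> \<le> C * r powr (- (q - 4))"
        using decay eventually_gt_at_top[of 0]
      proof eventually_elim
        case (elim r)
        have "r ^ 4 * f r powr (- q) \<le> r ^ 4 * (C * r powr (- q))"
          using elim by (intro mult_left_mono) auto
        also have "\<dots> = C * r powr (- (q - 4))"
          using powr_mult_power[of r "- q" 4] elim by (simp add: mult_ac)
        finally show ?case using flux[of r] elim True by simp
      qed
    qed (use q in simp)
  next
    case False
    have lim5: "((\<lambda>r. r powr (4 + 1) * f r powr (- q)) \<longlongrightarrow> 0) at_top"
    proof (rule tendsto_sandwich[of "\<lambda>_. 0" _ _ "\<lambda>r. C * r powr (5 - q)"])
      show "\<forall>\<^sub>F r in at_top. 0 \<le> r powr (4 + 1) * f r powr (- q)"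
        using decay by eventually_elim simp
      show "\<forall>\<^sub>F r in at_top. r powr (4 + 1) * f r powr (- q) \<le> C * r powr (5 - q)"
        using decay eventually_gt_at_top[of 0]
      proof eventually_elim
        case (elim r)
        then have "r powr 5 * f r powr (- q) \<le> r powr 5 * (C * r powr (- q))"
          by (intro mult_left_mono) auto
        then show ?case by (simp add: powr_diff powr_minus field_simps)
      qed
      show "((\<lambda>r. C * r powr (5 - q)) \<longlongrightarrow> 0) at_top"
        using q by (intro tendsto_mult_right_zero tendsto_neg_powr filterlim_ident) auto
    qed simp
    have "((\<lambda>r. r powr 4 * w1 r) \<longlongrightarrow> 0 / (real a - 4)) at_top"
      by (rule flux_tendsto[OF _ flux lim5]) (use a False in simp)
    then have "((\<lambda>r. r powr 4 * w1 r) \<longlongrightarrow> 0) at_top" by simp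
    then have "((\<lambda>r. r ^ 4 * w1 r) \<longlongrightarrow> 0) at_top"
      by (rule tendsto_at_top_transform_pos) simp
    then show ?thesis by blast
  qed
qed

lemma convergent_of_r4_deriv_convergent:
  fixes w w1 :: "real \<Rightarrow> real"
  assumes dw: "\<And>r. r > 0 \<Longrightarrow> (w has_real_derivative w1 r) (at r)"
    and K: "((\<lambda>r. r ^ 4 * w1 r) \<longlongrightarrow> K) at_top"
  shows "\<exists>L. (w \<longlongrightarrow> L) at_top"
proof (rule convergent_at_top_of_deriv_bound[of 4])
  have "\<forall>\<^sub>F r in at_top. \<bar>r ^ 4 * w1 r\<bar> \<le> \<bar>K\<bar> + 1"
    using tendstoD[OF K zero_less_one] by eventually_elim (auto simp: dist_real_def)
  then show "\<forall>\<^sub>F r in at_top. (w has_real_derivative w1 r) (at r) \<and> \<bar>w1 r\<bar> \<le> (\<bar>K\<bar> + 1) * r powr (- 4)"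
    using eventually_gt_at_top[of 0]
  proof eventually_elim
    case (elim r)
    then have "\<bar>w1 r\<bar> * r ^ 4 \<le> \<bar>K\<bar> + 1" by (simp add: abs_mult mult.commute)
    then show ?case using elim dw by (simp add: powr_minus field_simps)
  qed
qed simp

lemma flux_limit_eq_0:
  fixes v v1 w :: "real \<Rightarrow> real" and a :: nat
  assumes dv: "\<And>r. r > 0 \<Longrightarrow> (v has_real_derivative v1 r) (at r)"
    and flux: "\<And>r. r > 0 \<Longrightarrow> ((\<lambda>r. r ^ a * v1 r) has_real_derivative r ^ a * w r) (at r)"
    and L: "(w \<longlongrightarrow> L) at_top" and v0: "(v \<longlongrightarrow> 0) at_top"
  shows "L = 0"
proof -
  have w: "((\<lambda>r. r powr (- 1 + 1) * w r) \<longlongrightarrow> L) at_top"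
    by (rule tendsto_at_top_transform_pos[OF L]) simp
  have "((\<lambda>r. r powr (- 1) * v1 r) \<longlongrightarrow> L / (real a - - 1)) at_top"
    using flux_tendsto[OF _ flux w] by simp
  then have "((\<lambda>r. r powr (- 2) * v r) \<longlongrightarrow> L / (real a - - 1) / 2) at_top"
    by (intro tendsto_powr_mult_of_deriv) (auto intro: eventually_mono[OF eventually_gt_at_top] dv)
  moreover have "((\<lambda>r. r powr (- 2) * v r) \<longlongrightarrow> 0 * 0) at_top"
    by (intro tendsto_mult v0 tendsto_neg_powr filterlim_ident) simp
  ultimately have "L / (real a - - 1) / 2 = 0 * 0"
    by (rule tendsto_unique[OF trivial_limit_at_top_linorder])
  then show ?thesis by simp
qed

text \<open>With \<open>a = n - 1\<close>, the flux identities say \<open>v = \<Delta>f\<close>, \<open>w = \<Delta>v\<close> and \<open>\<Delta>w = f^(-q)\<close>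
  for the radial Laplacian \<open>\<Delta>\<close>.\<close>
lemma radial_ode_linear_growth:
  fixes f f1 v v1 w w1 :: "real \<Rightarrow> real" and a :: nat and q c :: real
  assumes a: "a \<ge> 4" and q: "q > 5" and c: "c > 0"
    and df: "\<And>r. r > 0 \<Longrightarrow> (f has_real_derivative f1 r) (at r)"
    and dv: "\<And>r. r > 0 \<Longrightarrow> (v has_real_derivative v1 r) (at r)"
    and dw: "\<And>r. r > 0 \<Longrightarrow> (w has_real_derivative w1 r) (at r)"
    and flux_f: "\<And>r. r > 0 \<Longrightarrow> ((\<lambda>r. r ^ a * f1 r) has_real_derivative r ^ a * v r) (at r)"
    and flux_v: "\<And>r. r > 0 \<Longrightarrow> ((\<lambda>r. r ^ a * v1 r) has_real_derivative r ^ a * w r) (at r)"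
    and flux_w: "\<And>r. r > 0 \<Longrightarrow> ((\<lambda>r. r ^ a * w1 r) has_real_derivative r ^ a * f r powr (- q)) (at r)"
    and grow: "\<forall>\<^sub>F r in at_top. c * r \<le> f r"
    and v0: "(v \<longlongrightarrow> 0) at_top"
  shows "\<exists>I. ((\<lambda>r. r\<^sup>2 * v1 r) \<longlongrightarrow> I) at_top \<and> ((\<lambda>r. f r / r) \<longlongrightarrow> - I / real a) at_top"
proof -
  have ev_pos: "\<forall>\<^sub>F r in at_top. r > (0::real)" by (rule eventually_gt_at_top)
  obtain K where K: "((\<lambda>r. r ^ 4 * w1 r) \<longlongrightarrow> K) at_top"
    using r4_flux_convergent[OF a q c flux_w grow] by blast
  obtain L where L: "(w \<longlongrightarrow> L) at_top"
    using convergent_of_r4_deriv_convergent[OF dw K] by blast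
  have w0: "(w \<longlongrightarrow> 0) at_top"
    using L flux_limit_eq_0[OF dv flux_v L v0] by simp
  have "((\<lambda>r. r powr (1 - - 3) * w1 r) \<longlongrightarrow> K) at_top"
    by (rule tendsto_at_top_transform_pos[OF K]) simp
  then have w3: "((\<lambda>r. r powr 3 * w r) \<longlongrightarrow> K / - 3) at_top"
    using tendsto_powr_mult_of_deriv[of "- 3" w w1 K] w0 by (auto intro: eventually_mono[OF ev_pos] dw)
  define I where "I = K / - 3 / (real a - 2)"
  have v2: "((\<lambda>r. r powr 2 * v1 r) \<longlongrightarrow> I) at_top"
    unfolding I_def by (rule flux_tendsto[OF _ flux_v]) (use a w3 in simp_all)
  have v1: "((\<lambda>r. r powr 1 * v r) \<longlongrightarrow> I / - 1) at_top"
    using tendsto_powr_mult_of_deriv[of "- 1" v v1 I] v0 v2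
    by (auto intro: eventually_mono[OF ev_pos] dv)
  have f1: "((\<lambda>r. r powr 0 * f1 r) \<longlongrightarrow> I / - 1 / (real a - 0)) at_top"
    by (rule flux_tendsto[OF _ flux_f]) (use a v1 in simp_all)
  have "((\<lambda>r. r powr (- 1) * f r) \<longlongrightarrow> I / - 1 / (real a - 0) / 1) at_top"
    by (rule tendsto_powr_mult_of_deriv) (use f1 in \<open>auto intro: eventually_mono[OF ev_pos] df\<close>)
  then have "((\<lambda>r. r powr (- 1) * f r) \<longlongrightarrow> - I / real a) at_top" by simp
  then have "((\<lambda>r. f r / r) \<longlongrightarrow> - I / real a) at_top"
    by (rule tendsto_at_top_transform_pos) (simp add: powr_minus divide_inverse mult.commute)
  moreover have "((\<lambda>r. r\<^sup>2 * v1 r) \<longlongrightarrow> I) at_top"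
    by (rule tendsto_at_top_transform_pos[OF v2]) simp
  ultimately show ?thesis by blast
qed

lemma radial_lap_eq:
  assumes n: "n \<ge> 1"
    and d1: "\<And>s. s > 0 \<Longrightarrow> (h has_real_derivative h1 s) (at s)"
    and d2: "\<And>s. s > 0 \<Longrightarrow> (h1 has_real_derivative h2 s) (at s)"
    and r: "r > 0"
  shows "radial_lap n h r = h2 r + (real n - 1) * h1 r / r"
proof -
  have "((\<lambda>s. s ^ (n - 1) * deriv h s) has_real_derivative
      r ^ (n - 1) * (h2 r + real (n - 1) * h1 r / r)) (at r)"
  proof (rule has_field_derivative_transform_within_open
      [OF has_real_derivative_power_mult[OF d2[OF r] r], of "{0<..}"])
    fix s :: real assume "s \<in> {0<..}"
    then show "s ^ (n - 1) * h1 s = s ^ (n - 1) * deriv h s"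
      using DERIV_imp_deriv[OF d1, of s] by simp
  qed (use r in auto)
  moreover have "r powr (1 - real n) * r ^ (n - 1) = 1"
    using powr_mult_power[OF r, of "1 - real n" "n - 1"] n r by (simp add: of_nat_diff)
  ultimately show ?thesis
    unfolding radial_lap_def using n by (simp add: DERIV_imp_deriv mult.assoc[symmetric] of_nat_diff)
qed

lemma radial_lap_flux:
  assumes n: "n \<ge> 1"
    and d1: "\<And>s. s > 0 \<Longrightarrow> (h has_real_derivative h1 s) (at s)"
    and d2: "\<And>s. s > 0 \<Longrightarrow> (h1 has_real_derivative h2 s) (at s)"
    and r: "r > 0"
  shows "((\<lambda>s. s ^ (n - 1) * h1 s) has_real_derivative r ^ (n - 1) * radial_lap n h r) (at r)"
  using has_real_derivative_power_mult[OF d2[OF r] r, of "n - 1"] radial_lap_eq[OF n d1 d2 r] n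
  by (simp add: of_nat_diff)

lemma partial_radial:
  fixes G :: "'a::euclidean_space \<Rightarrow> real"
  assumes G: "\<And>y. y \<noteq> 0 \<Longrightarrow> G y = h (norm y)"
    and d1: "\<And>r. r > 0 \<Longrightarrow> (h has_real_derivative h1 r) (at r)"
    and y: "y \<noteq> 0"
  shows "partial G i y = h1 (norm y) / norm y * inner y i"
proof -
  have "GDERIV (\<lambda>y. h (norm y)) y :> h1 (norm y) *\<^sub>R sgn y"
    by (rule GDERIV_DERIV_compose[OF GDERIV_norm[OF y] d1]) (use y in simp)
  then have "((\<lambda>y. h (norm y)) has_derivative (\<lambda>z. inner z (h1 (norm y) *\<^sub>R sgn y))) (at y)"
    by (simp add: gderiv_def)
  then have "(G has_derivative (\<lambda>z. inner z (h1 (norm y) *\<^sub>R sgn y))) (at y)"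
    by (rule has_derivative_transform_within_open[OF _ open_Compl[OF closed_singleton]])
      (use y G in auto)
  then have "frechet_derivative G (at y) = (\<lambda>z. inner z (h1 (norm y) *\<^sub>R sgn y))"
    by (rule frechet_derivative_at[symmetric])
  then show ?thesis
    unfolding partial_def by (simp add: sgn_div_norm inner_commute divide_inverse)
qed

lemma partial_partial_radial:
  fixes P :: "'a::euclidean_space \<Rightarrow> real"
  assumes P: "\<And>y. y \<noteq> 0 \<Longrightarrow> P y = \<phi> (norm y) * inner y i"
    and d\<phi>: "\<And>t. t > 0 \<Longrightarrow> (\<phi> has_real_derivative \<phi>' t) (at t)"
    and x: "x \<noteq> 0" and i: "i \<in> Basis"
  shows "partial P i x = \<phi> (norm x) + \<phi>' (norm x) * (inner x i)\<^sup>2 / norm x"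
proof -
  define D where "D = \<phi> (norm x) *\<^sub>R i + inner x i *\<^sub>R (\<phi>' (norm x) *\<^sub>R sgn x)"
  have g1: "GDERIV (\<lambda>y. \<phi> (norm y)) x :> \<phi>' (norm x) *\<^sub>R sgn x"
    by (rule GDERIV_DERIV_compose[OF GDERIV_norm[OF x] d\<phi>]) (use x in simp)
  have g2: "GDERIV (\<lambda>y. inner y i) x :> i"
    unfolding gderiv_def by (rule has_derivative_inner_left[OF has_derivative_ident])
  have "GDERIV (\<lambda>y. \<phi> (norm y) * inner y i) x :> D"
    unfolding D_def by (rule GDERIV_mult[OF g1 g2])
  then have "((\<lambda>y. \<phi> (norm y) * inner y i) has_derivative (\<lambda>z. inner z D)) (at x)"
    by (simp add: gderiv_def)
  then have "(P has_derivative (\<lambda>z. inner z D)) (at x)"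
    by (rule has_derivative_transform_within_open[OF _ open_Compl[OF closed_singleton]])
      (use x P in auto)
  then have "frechet_derivative P (at x) = (\<lambda>z. inner z D)"
    by (rule frechet_derivative_at[symmetric])
  then have "partial P i x = inner i D" by (simp add: partial_def)
  also have "\<dots> = \<phi> (norm x) + \<phi>' (norm x) * (inner x i)\<^sup>2 / norm x"
    using i by (simp add: D_def inner_add_right sgn_div_norm inner_commute power2_eq_square divide_inverse)
  finally show ?thesis .
qed

lemma laplacian_radial:
  fixes G :: "'a::euclidean_space \<Rightarrow> real"
  assumes G: "\<And>y. y \<noteq> 0 \<Longrightarrow> G y = h (norm y)"
    and d1: "\<And>r. r > 0 \<Longrightarrow> (h has_real_derivative h1 r) (at r)"
    and d2: "\<And>r. r > 0 \<Longrightarrow> (h1 has_real_derivative h2 r) (at r)"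
    and x: "x \<noteq> 0"
  shows "laplacian G x = radial_lap DIM('a) h (norm x)"
proof -
  define \<phi> where "\<phi> t = h1 t / t" for t
  define \<phi>' where "\<phi>' t = h2 t / t - h1 t / t\<^sup>2" for t
  have d\<phi>: "(\<phi> has_real_derivative \<phi>' t) (at t)" if "t > 0" for t
  proof -
    have "(\<phi> has_real_derivative (h2 t * t - h1 t * 1) / (t * t)) (at t)"
      unfolding \<phi>_def by (rule DERIV_divide[OF d2[OF that] DERIV_ident]) (use that in simp)
    then show ?thesis
      unfolding \<phi>'_def using that by (simp add: diff_divide_distrib power2_eq_square)
  qed
  have "partial (partial G i) i x = \<phi> (norm x) + \<phi>' (norm x) * (inner x i)\<^sup>2 / norm x"
    if "i \<in> Basis" for i
    by (rule partial_partial_radial[OF _ d\<phi> x that]) (simp add: partial_radial[OF G d1] \<phi>_def)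
  then have "laplacian G x = (\<Sum>i\<in>Basis. \<phi> (norm x) + \<phi>' (norm x) * (inner x i)\<^sup>2 / norm x)"
    unfolding laplacian_def by simp
  also have "\<dots> = real DIM('a) * \<phi> (norm x) + \<phi>' (norm x) / norm x * (\<Sum>i\<in>Basis. (inner x i)\<^sup>2)"
    by (simp add: sum.distrib sum_distrib_left sum_divide_distrib)
  also have "(\<Sum>i\<in>Basis. (inner x i)\<^sup>2) = (norm x)\<^sup>2"
    using euclidean_inner[of x x] power2_norm_eq_inner[of x] by (simp add: power2_eq_square)
  also have "real DIM('a) * \<phi> (norm x) + \<phi>' (norm x) / norm x * (norm x)\<^sup>2
      = h2 (norm x) + (real DIM('a) - 1) * h1 (norm x) / norm x"
    unfolding \<phi>_def \<phi>'_def using x by (simp add: field_simps power2_eq_square)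
  also have "\<dots> = radial_lap DIM('a) h (norm x)"
    by (rule radial_lap_eq[symmetric, OF _ d1 d2]) (use x in auto)
  finally show ?thesis .
qed

fun smooth_on_pos :: "nat \<Rightarrow> (real \<Rightarrow> real) \<Rightarrow> bool" where
  "smooth_on_pos 0 h = True"
| "smooth_on_pos (Suc k) h = (\<exists>h'. (\<forall>r>0. (h has_real_derivative h' r) (at r)) \<and> smooth_on_pos k h')"

lemma smooth_on_pos_Suc_imp: "smooth_on_pos (Suc k) h \<Longrightarrow> smooth_on_pos k h"
proof (induction k arbitrary: h)
  case (Suc k)
  then obtain h' where "\<forall>r>0. (h has_real_derivative h' r) (at r)" "smooth_on_pos (Suc k) h'" by auto
  then show ?case using Suc.IH by auto
qed simp

lemma smooth_on_pos_const: "smooth_on_pos k (\<lambda>r. c)"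
proof (induction k arbitrary: c)
  case (Suc k)
  then show ?case by (auto intro!: exI[of _ "\<lambda>r. 0"])
qed simp

lemma smooth_on_pos_add:
  "smooth_on_pos k f \<Longrightarrow> smooth_on_pos k g \<Longrightarrow> smooth_on_pos k (\<lambda>r. f r + g r)"
proof (induction k arbitrary: f g)
  case (Suc k)
  then obtain f' g' where "\<forall>r>0. (f has_real_derivative f' r) (at r)" "smooth_on_pos k f'"
    "\<forall>r>0. (g has_real_derivative g' r) (at r)" "smooth_on_pos k g'"
    by auto
  then show ?case using Suc.IH[of f' g'] by (auto intro!: exI[of _ "\<lambda>r. f' r + g' r"] DERIV_add)
qed simp

lemma smooth_on_pos_mult:
  "smooth_on_pos k f \<Longrightarrow> smooth_on_pos k g \<Longrightarrow> smooth_on_pos k (\<lambda>r. f r * g r)"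
proof (induction k arbitrary: f g)
  case (Suc k)
  then obtain f' g' where d: "\<forall>r>0. (f has_real_derivative f' r) (at r)" "smooth_on_pos k f'"
    "\<forall>r>0. (g has_real_derivative g' r) (at r)" "smooth_on_pos k g'"
    by auto
  have "smooth_on_pos k (\<lambda>r. f r * g' r + f' r * g r)"
    using Suc.IH[of f' g] Suc.IH[of f g'] d
      smooth_on_pos_Suc_imp[OF Suc.prems(1)] smooth_on_pos_Suc_imp[OF Suc.prems(2)]
    by (intro smooth_on_pos_add) auto
  moreover have "\<forall>r>0. ((\<lambda>r. f r * g r) has_real_derivative f r * g' r + f' r * g r) (at r)"
    using d by (auto intro!: DERIV_mult')
  ultimately show ?case by auto
qed simp

lemma smooth_on_pos_inverse: "smooth_on_pos k (\<lambda>r. 1 / r)"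
proof (induction k)
  case (Suc k)
  have "smooth_on_pos k (\<lambda>r. (- 1) * ((1 / r) * (1 / r)))"
    by (intro smooth_on_pos_mult smooth_on_pos_const Suc.IH)
  moreover have "((\<lambda>r::real. 1 / r) has_real_derivative (- 1) * ((1 / r) * (1 / r))) (at r)"
    if "r > 0" for r
    using DERIV_divide[OF DERIV_const[of 1] DERIV_ident, of r] that by simp
  ultimately show ?case by (auto intro!: exI[of _ "\<lambda>r. (- 1) * ((1 / r) * (1 / r))"])
qed simp

lemma smooth_on_pos_chain:
  assumes "\<And>j r. j < N \<Longrightarrow> (F j has_real_derivative F (Suc j) r) (at r)"
  shows "j + k \<le> N \<Longrightarrow> smooth_on_pos k (F j)"
proof (induction k arbitrary: j)
  case (Suc k)
  have "smooth_on_pos k (F (Suc j))" using Suc by simp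
  moreover have "\<forall>r>0. (F j has_real_derivative F (Suc j) r) (at r)" using assms Suc.prems by simp
  ultimately show ?case by auto
qed simp

lemma smooth_on_pos_cong:
  assumes "smooth_on_pos k f" and eq: "\<And>r. r > 0 \<Longrightarrow> f r = g r"
  shows "smooth_on_pos k g"
proof (cases k)
  case (Suc k')
  then obtain f' where f': "\<forall>r>0. (f has_real_derivative f' r) (at r)" "smooth_on_pos k' f'"
    using assms(1) by auto
  have "(g has_real_derivative f' r) (at r)" if "r > 0" for r
    by (rule has_field_derivative_transform_within_open[OF f'(1)[rule_format, OF that], of "{0<..}"])
      (use that eq in auto)
  then show ?thesis using f'(2) Suc by auto
qed simp

lemma smooth_on_pos_radial_lap:
  assumes n: "n \<ge> 1" and h: "smooth_on_pos (Suc (Suc k)) h"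
  shows "smooth_on_pos k (radial_lap n h)"
proof -
  obtain h1 h2 where d1: "\<forall>r>0. (h has_real_derivative h1 r) (at r)"
    and d2: "\<forall>r>0. (h1 has_real_derivative h2 r) (at r)"
    and h1: "smooth_on_pos (Suc k) h1" and h2: "smooth_on_pos k h2"
    using h by auto
  have "smooth_on_pos k (\<lambda>r. h2 r + (real n - 1) * (h1 r * (1 / r)))"
    by (intro smooth_on_pos_add smooth_on_pos_mult smooth_on_pos_const smooth_on_pos_inverse h2
        smooth_on_pos_Suc_imp[OF h1])
  then show ?thesis
    by (rule smooth_on_pos_cong) (use radial_lap_eq[OF n, of h h1 h2] d1 d2 in simp)
qed

fun iter_dir_deriv :: "'a \<Rightarrow> nat \<Rightarrow> ('a::euclidean_space \<Rightarrow> real) \<Rightarrow> 'a \<Rightarrow> real" where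
  "iter_dir_deriv e 0 g = g"
| "iter_dir_deriv e (Suc k) g = (\<lambda>x. frechet_derivative (iter_dir_deriv e k g) (at x) e)"

lemma Ck_iter_dir_deriv: "e \<in> Basis \<Longrightarrow> Ck (k + m) g \<Longrightarrow> Ck m (iter_dir_deriv e k g)"
proof (induction k arbitrary: m)
  case (Suc k)
  have "Ck (Suc m) (iter_dir_deriv e k g)" using Suc.IH[of "Suc m"] Suc.prems by simp
  then show ?case using Suc.prems(1) by simp
qed simp

lemma Ck_line_deriv:
  assumes "Ck (Suc m) G"
  shows "((\<lambda>r. G (r *\<^sub>R e)) has_real_derivative frechet_derivative G (at (r *\<^sub>R e)) e) (at r)"
proof -
  have "G differentiable (at (r *\<^sub>R e))"
    using assms by (auto simp: differentiable_on_def)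
  then have gd: "(G has_derivative frechet_derivative G (at (r *\<^sub>R e))) (at (r *\<^sub>R e))"
    by (rule frechet_derivative_works[THEN iffD1])
  have ld: "((\<lambda>r. r *\<^sub>R e) has_derivative (\<lambda>t. t *\<^sub>R e)) (at r)"
    by (rule derivative_eq_intros refl)+ simp
  have "((\<lambda>r. G (r *\<^sub>R e)) has_derivative (\<lambda>t. frechet_derivative G (at (r *\<^sub>R e)) (t *\<^sub>R e))) (at r)"
    using has_derivative_compose[OF ld gd] by simp
  moreover have "frechet_derivative G (at (r *\<^sub>R e)) (t *\<^sub>R e) = frechet_derivative G (at (r *\<^sub>R e)) e * t"
    for t
    using linear_scale[OF has_derivative_linear[OF gd]] by (simp add: mult.commute)
  ultimately show ?thesis by (simp add: has_field_derivative_def)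
qed

lemma radial_profile_derivs:
  fixes u :: "'a::euclidean_space \<Rightarrow> real"
  assumes reg: "Ck 6 u" and radial: "\<And>x y. norm x = norm y \<Longrightarrow> u x = u y"
  obtains F where "\<And>j r. j < 6 \<Longrightarrow> (F j has_real_derivative F (Suc j) r) (at r)"
    and "F 0 = radial_profile u" and "\<And>y. u y = F 0 (norm y)" and "F 1 0 = 0"
proof -
  define e :: 'a where "e = (SOME b. b \<in> Basis)"
  have eB: "e \<in> Basis" unfolding e_def by (rule someI_ex) (use nonempty_Basis in blast)
  define F where "F j r = iter_dir_deriv e j u (r *\<^sub>R e)" for j r
  have dF: "(F j has_real_derivative F (Suc j) r) (at r)" if "j < 6" for j r
  proof -
    have "Ck (Suc (5 - j)) (iter_dir_deriv e j u)"
      using Ck_iter_dir_deriv[OF eB, of j "Suc (5 - j)" u] reg that by simp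
    from Ck_line_deriv[OF this, of e r] show ?thesis unfolding F_def by simp
  qed
  have uF: "u y = F 0 (norm y)" for y
    unfolding F_def using radial[of y "norm y *\<^sub>R e"] eB by simp
  text \<open>The profile is even, so its derivative vanishes at the origin.\<close>
  have "F 1 0 = 0"
  proof -
    have even: "F 0 (- r) = F 0 r" for r
      using uF[of "r *\<^sub>R e"] uF[of "(- r) *\<^sub>R e"] by (simp add: F_def)
    have "(F 0 has_real_derivative F 1 (- 0)) (at (- 0))" using dF[of 0] by simp
    from DERIV_mirror[THEN iffD1, OF this] have "(F 0 has_real_derivative - F 1 0) (at 0)"
      by (simp add: even)
    from DERIV_unique[OF dF[of 0 0] this] show ?thesis by simp
  qed
  moreover have "F 0 = radial_profile u" unfolding F_def radial_profile_def e_def by auto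
  ultimately show ?thesis using that dF uF by blast
qed

lemma has_integral_Ici_of_tendsto:
  fixes g J :: "real \<Rightarrow> real"
  assumes fin: "\<And>b. b > a \<Longrightarrow> (g has_integral J b) {a..b}"
    and lim: "(J \<longlongrightarrow> I) at_top"
  shows "(g has_integral I) {a..}"
proof -
  have unbounded: "\<not> (\<exists>c d. {a..} = cbox c d)"
  proof
    assume "\<exists>c d. {a..} = cbox c d"
    then obtain c d :: real where eq: "{a..} = cbox c d" by blast
    have "max (d + 1) a \<in> cbox c d" using eq by (metis atLeast_iff max.cobounded2)
    then show False by simp
  qed
  show ?thesis
  proof (subst has_integral_alt, simp only: unbounded if_False, intro allI impI)
    fix e :: real assume e: "e > 0"
    obtain B0 where B0: "\<And>b. b \<ge> B0 \<Longrightarrow> \<bar>J b - I\<bar> < e"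
      using tendstoD[OF lim e] unfolding eventually_at_top_linorder dist_real_def by auto
    define B where "B = 2 * (max B0 \<bar>a\<bar> + 1)"
    show "\<exists>B>0. \<forall>c d. ball 0 B \<subseteq> cbox c d \<longrightarrow>
      (\<exists>z. ((\<lambda>x. if x \<in> {a..} then g x else 0) has_integral z) (cbox c d) \<and> norm (z - I) < e)"
    proof (intro exI conjI allI impI)
      show "B > 0" unfolding B_def by simp
      fix c d :: real assume sub: "ball 0 B \<subseteq> cbox c d"
      have "B / 2 \<in> ball 0 B" "- B / 2 \<in> ball 0 B" unfolding B_def by auto
      then have "B / 2 \<in> cbox c d" "- B / 2 \<in> cbox c d" using sub by blast+
      then have "B / 2 \<le> d" "c \<le> - B / 2" by auto
      then have d: "d \<ge> B0" "d > a" "c \<le> a" unfolding B_def by auto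
      have "((\<lambda>x. if x \<in> cbox a d then g x else 0) has_integral J d) (cbox c d)"
        by (rule has_integral_restrict_closed_subinterval) (use fin[OF d(2)] d in auto)
      then show "((\<lambda>x. if x \<in> {a..} then g x else 0) has_integral J d) (cbox c d)"
        by (rule has_integral_eq[rotated]) auto
      show "norm (J d - I) < e" using B0[OF d(1)] by simp
    qed
  qed
qed

lemma has_integral_Ici_of_antiderivative:
  fixes g Z :: "real \<Rightarrow> real"
  assumes dZ: "\<And>t. t > 0 \<Longrightarrow> (Z has_real_derivative g t) (at t)"
    and Z0: "(Z \<longlongrightarrow> Z 0) (at_right 0)"
    and lim: "(Z \<longlongrightarrow> I) at_top"
  shows "(g has_integral I - Z 0) {0..}"
proof (rule has_integral_Ici_of_tendsto)
  fix b :: real assume b: "b > 0"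
  have "continuous_on {0..b} Z"
  proof (clarsimp simp: continuous_on_eq_continuous_within)
    fix t assume t: "0 \<le> t" "t \<le> b"
    show "continuous (at t within {0..b}) Z"
    proof (cases "t = 0")
      case True
      then show ?thesis
        unfolding continuous_within using at_within_Icc_at_right[OF b] Z0 by simp
    next
      case False
      then have "isCont Z t" using dZ[of t] t by (intro DERIV_isCont) auto
      then show ?thesis by (rule continuous_at_imp_continuous_at_within)
    qed
  qed
  moreover have "(Z has_vector_derivative g t) (at t)" if "t \<in> {0<..<b}" for t
    using dZ[of t] that by (simp add: has_real_derivative_iff_has_vector_derivative)
  ultimately show "(g has_integral Z b - Z 0) {0..b}"
    using fundamental_theorem_of_calculus_interior[of 0 b Z g] b by auto
next
  show "((\<lambda>b. Z b - Z 0) \<longlongrightarrow> I - Z 0) at_top" by (intro tendsto_intros lim)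
qed

lemma radial_integrand_has_integral:
  fixes F :: "nat \<Rightarrow> real \<Rightarrow> real" and v1 v2 :: "real \<Rightarrow> real"
  assumes n: "n \<ge> 1"
    and dF: "\<And>j r. j < 4 \<Longrightarrow> (F j has_real_derivative F (Suc j) r) (at r)"
    and F1: "F 1 0 = 0"
    and dv: "\<And>r. r > 0 \<Longrightarrow> (radial_lap n (F 0) has_real_derivative v1 r) (at r)"
    and dv1: "\<And>r. r > 0 \<Longrightarrow> (v1 has_real_derivative v2 r) (at r)"
    and lim: "((\<lambda>r. r\<^sup>2 * v1 r) \<longlongrightarrow> I) at_top"
  shows "((\<lambda>t. t\<^sup>2 * (radial_lap n (radial_lap n (F 0)) t
            - (real n - 3) / t * deriv (radial_lap n (F 0)) t)) has_integral I) {0..}"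
proof -
  define a where "a = real n - 1"
  have dF0: "(F 0 has_real_derivative F 1 r) (at r)" and dF1: "(F 1 has_real_derivative F 2 r) (at r)"
    and dF2: "(F 2 has_real_derivative F 3 r) (at r)" for r
    using dF[of 0 r] dF[of 1 r] dF[of 2 r] by (simp_all add: numeral_eq_Suc)
  define Z where "Z t = t\<^sup>2 * v1 t" for t
  have dZ: "(Z has_real_derivative t\<^sup>2 * (radial_lap n (radial_lap n (F 0)) t
            - (real n - 3) / t * deriv (radial_lap n (F 0)) t)) (at t)" if t: "t > 0" for t
  proof -
    have "(Z has_real_derivative t\<^sup>2 * v2 t + 2 * t * v1 t) (at t)"
      unfolding Z_def by (auto intro!: derivative_eq_intros dv1 t)
    moreover have "t\<^sup>2 * (radial_lap n (radial_lap n (F 0)) t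
        - (real n - 3) / t * deriv (radial_lap n (F 0)) t) = t\<^sup>2 * v2 t + 2 * t * v1 t"
    proof -
      have L2: "radial_lap n (radial_lap n (F 0)) t = v2 t + (real n - 1) * v1 t / t"
        by (rule radial_lap_eq[OF n dv dv1 t])
      have D: "deriv (radial_lap n (F 0)) t = v1 t" by (rule DERIV_imp_deriv[OF dv[OF t]])
      show ?thesis unfolding L2 D using t by (simp add: field_simps power2_eq_square)
    qed
    ultimately show ?thesis by simp
  qed
  have v1_eq: "v1 t = F 3 t + a * (F 2 t / t - F 1 t / t\<^sup>2)" if t: "t > 0" for t
  proof -
    have "((\<lambda>t. F 2 t + a * (F 1 t / t)) has_real_derivative
        F 3 t + a * ((F 2 t * t - F 1 t * 1) / (t * t))) (at t)"
      by (intro DERIV_add DERIV_cmult DERIV_divide dF1 dF2 DERIV_ident) (use t in simp)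
    moreover have "F 3 t + a * ((F 2 t * t - F 1 t * 1) / (t * t)) = F 3 t + a * (F 2 t / t - F 1 t / t\<^sup>2)"
      using t by (simp add: field_simps power2_eq_square)
    ultimately have "((\<lambda>t. F 2 t + a * (F 1 t / t)) has_real_derivative
        F 3 t + a * (F 2 t / t - F 1 t / t\<^sup>2)) (at t)" by simp
    then have "(radial_lap n (F 0) has_real_derivative F 3 t + a * (F 2 t / t - F 1 t / t\<^sup>2)) (at t)"
    proof (rule has_field_derivative_transform_within_open[of _ _ _ "{0<..}"])
      fix s :: real assume "s \<in> {0<..}"
      then show "F 2 s + a * (F 1 s / s) = radial_lap n (F 0) s"
        unfolding a_def using radial_lap_eq[OF n dF0 dF1, of s] by simp
    qed (use t in auto)
    then show ?thesis by (rule DERIV_unique[OF dv[OF t]])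
  qed
  text \<open>Near the origin \<open>Z\<close> tends to \<open>-a F\<^sub>1(0) = 0\<close>.\<close>
  have "(Z \<longlongrightarrow> Z 0) (at_right 0)"
  proof -
    have "isCont (F 1) 0" "isCont (F 2) 0" "isCont (F 3) 0"
      using DERIV_isCont[OF dF1] DERIV_isCont[OF dF2] DERIV_isCont[OF dF[of 3]] by auto
    then have "((\<lambda>t. t\<^sup>2 * F 3 t + a * (t * F 2 t - F 1 t)) \<longlongrightarrow> 0\<^sup>2 * F 3 0 + a * (0 * F 2 0 - F 1 0)) (at 0)"
      unfolding isCont_def by (intro tendsto_intros) auto
    then have "((\<lambda>t. t\<^sup>2 * F 3 t + a * (t * F 2 t - F 1 t)) \<longlongrightarrow> Z 0) (at_right 0)"
      using F1 filterlim_at_split by (auto simp: Z_def)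
    then show ?thesis
    proof (rule Lim_transform_eventually)
      show "\<forall>\<^sub>F t in at_right 0. t\<^sup>2 * F 3 t + a * (t * F 2 t - F 1 t) = Z t"
        using eventually_at_right_less[of "0::real"]
        by eventually_elim (simp add: Z_def v1_eq field_simps power2_eq_square)
    qed
  qed
  from has_integral_Ici_of_antiderivative[OF dZ this] lim show ?thesis
    by (simp add: Z_def[abs_def])
qed

lemma radial_lap_tendsto_0:
  fixes f f1 f2 :: "real \<Rightarrow> real"
  assumes n: "n \<ge> 1"
    and df: "\<And>r. (f has_real_derivative f1 r) (at r)"
    and df1: "\<And>r. (f1 has_real_derivative f2 r) (at r)"
    and f2: "(f2 \<longlongrightarrow> 0) at_top"
  shows "(radial_lap n f \<longlongrightarrow> 0) at_top"
proof -
  have "((\<lambda>r. r powr (1 - 1) * f2 r) \<longlongrightarrow> 0) at_top"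
    by (rule tendsto_at_top_transform_pos[OF f2]) simp
  then have "((\<lambda>r. r powr (- 1) * f1 r) \<longlongrightarrow> 0 / 1) at_top"
    by (rule tendsto_powr_mult_of_deriv[rotated 3]) (simp_all add: df1 always_eventually)
  then have "((\<lambda>r. r powr (- 1) * f1 r) \<longlongrightarrow> 0) at_top" by simp
  then have "((\<lambda>r. f2 r + (real n - 1) * (r powr (- 1) * f1 r)) \<longlongrightarrow> 0) at_top"
    by (rule tendsto_add_zero[OF f2 tendsto_mult_right_zero])
  then show ?thesis
    by (rule tendsto_at_top_transform_pos)
      (simp add: radial_lap_eq[OF n df df1] powr_minus divide_inverse)
qed

lemma triharmonic_radial_linear_limit:
  fixes u :: "'a::euclidean_space \<Rightarrow> real" and F :: "nat \<Rightarrow> real \<Rightarrow> real" and q c :: real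
  assumes dim: "DIM('a) \<ge> 5" and q: "q > 5"
    and dF: "\<And>j r. j < 6 \<Longrightarrow> (F j has_real_derivative F (Suc j) r) (at r)"
    and F1: "F 1 0 = 0" and uF: "\<And>y. u y = F 0 (norm y)"
    and eqn: "\<And>x. laplacian (laplacian (laplacian u)) x = u x powr (- q)"
    and c: "c > 0" and grow: "\<forall>\<^sub>F r in at_top. c * r \<le> F 0 r"
    and F2: "(F 2 \<longlongrightarrow> 0) at_top"
  shows "\<exists>I. ((\<lambda>t. t\<^sup>2 * (radial_lap DIM('a) (radial_lap DIM('a) (F 0)) t
            - (real DIM('a) - 3) / t * deriv (radial_lap DIM('a) (F 0)) t)) has_integral I) {0..}
          \<and> ((\<lambda>r. F 0 r / r) \<longlongrightarrow> - I / (real DIM('a) - 1)) at_top"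
proof -
  define n where "n = DIM('a)"
  have n: "n \<ge> 1" "n - 1 \<ge> 4" "real (n - 1) = real n - 1" using dim by (auto simp: n_def of_nat_diff)
  have dF0: "(F 0 has_real_derivative F 1 r) (at r)" and dF1: "(F 1 has_real_derivative F 2 r) (at r)" for r
    using dF[of 0 r] dF[of 1 r] by (simp_all add: numeral_eq_Suc)
  define v where "v = radial_lap n (F 0)"
  define w where "w = radial_lap n v"
  have "smooth_on_pos 6 (F 0)" by (rule smooth_on_pos_chain[of 6 F]) (use dF in auto)
  then have "smooth_on_pos 4 v"
    unfolding v_def using smooth_on_pos_radial_lap[OF n(1), of 4] by (simp add: numeral_eq_Suc)
  then obtain v1 v2 where dv: "\<And>r. r > 0 \<Longrightarrow> (v has_real_derivative v1 r) (at r)"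
    and dv1: "\<And>r. r > 0 \<Longrightarrow> (v1 has_real_derivative v2 r) (at r)"
    by (auto simp: numeral_eq_Suc)
  have "smooth_on_pos 2 w"
    unfolding w_def using \<open>smooth_on_pos 4 v\<close> smooth_on_pos_radial_lap[OF n(1), of 2]
    by (simp add: numeral_eq_Suc)
  then obtain w1 w2 where dw: "\<And>r. r > 0 \<Longrightarrow> (w has_real_derivative w1 r) (at r)"
    and dw1: "\<And>r. r > 0 \<Longrightarrow> (w1 has_real_derivative w2 r) (at r)"
    by (auto simp: numeral_eq_Suc)
  have lap1: "laplacian u y = v (norm y)" if "y \<noteq> 0" for y
    unfolding v_def n_def by (rule laplacian_radial[OF uF dF0 dF1 that])
  have lap2: "laplacian (laplacian u) y = w (norm y)" if "y \<noteq> 0" for y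
    unfolding w_def n_def by (rule laplacian_radial[OF lap1 dv dv1 that, unfolded n_def])
  have ode: "radial_lap n w r = F 0 r powr (- q)" if r: "r > 0" for r
  proof -
    obtain e :: 'a where e: "e \<in> Basis" using nonempty_Basis by blast
    then have y: "r *\<^sub>R e \<noteq> 0" "norm (r *\<^sub>R e) = r" using r by auto
    show ?thesis
      using laplacian_radial[OF lap2 dw dw1 y(1)] eqn[of "r *\<^sub>R e"] uF[of "r *\<^sub>R e"] dim y(2)
      by (simp add: n_def)
  qed
  have v0: "(v \<longlongrightarrow> 0) at_top"
    unfolding v_def by (rule radial_lap_tendsto_0[OF n(1) dF0 dF1 F2])
  obtain I where I: "((\<lambda>r. r\<^sup>2 * v1 r) \<longlongrightarrow> I) at_top"
    and lim: "((\<lambda>r. F 0 r / r) \<longlongrightarrow> - I / real (n - 1)) at_top"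
  proof (rule radial_ode_linear_growth[OF n(2) q c, of "F 0" "F 1" v v1 w w1, THEN exE])
    show "((\<lambda>r. r ^ (n - 1) * F 1 r) has_real_derivative r ^ (n - 1) * v r) (at r)" if "r > 0" for r
      unfolding v_def by (rule radial_lap_flux[OF n(1) dF0 dF1 that])
    show "((\<lambda>r. r ^ (n - 1) * v1 r) has_real_derivative r ^ (n - 1) * w r) (at r)" if "r > 0" for r
      unfolding w_def by (rule radial_lap_flux[OF n(1) dv dv1 that])
    show "((\<lambda>r. r ^ (n - 1) * w1 r) has_real_derivative r ^ (n - 1) * F 0 r powr (- q)) (at r)" if "r > 0" for r
      using radial_lap_flux[OF n(1) dw dw1 that] ode[OF that] by simp
  qed (use dF0 dv dw grow v0 in auto)
  have "((\<lambda>t. t\<^sup>2 * (radial_lap n (radial_lap n (F 0)) t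
            - (real n - 3) / t * deriv (radial_lap n (F 0)) t)) has_integral I) {0..}"
    by (rule radial_integrand_has_integral[OF n(1) _ F1 dv[unfolded v_def] dv1 I]) (use dF in simp)
  then show ?thesis using lim n(3) unfolding n_def by auto
qed

lemma liminf_ratio_pos_imp_linear_lower_bound:
  fixes u :: "'a::euclidean_space \<Rightarrow> real" and f :: "real \<Rightarrow> real"
  assumes growth: "Liminf at_infinity (\<lambda>x. ereal (u x / norm x)) > 0"
    and uf: "\<And>y. u y = f (norm y)"
  obtains c where "c > 0" and "\<forall>\<^sub>F r in at_top. c * r \<le> f r"
proof -
  obtain c0 where c0: "0 < ereal c0" "ereal c0 < Liminf at_infinity (\<lambda>x. ereal (u x / norm x))"
    using ereal_dense2[OF growth] by blast
  have "ereal (c0 / 2) < ereal c0" using c0(1) by simp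
  then have "\<forall>\<^sub>F x in at_infinity. ereal (c0 / 2) < ereal (u x / norm x)"
    using le_Liminf_iff[THEN iffD1, OF less_imp_le[OF c0(2)]] by blast
  then obtain B where B: "\<And>x. B \<le> norm x \<Longrightarrow> c0 / 2 < u x / norm x"
    unfolding eventually_at_infinity by auto
  obtain e :: 'a where e: "e \<in> Basis" using nonempty_Basis by blast
  show ?thesis
  proof (rule that)
    show "c0 / 2 > 0" using c0 by simp
    show "\<forall>\<^sub>F r in at_top. c0 / 2 * r \<le> f r"
      using eventually_ge_at_top[of "max B 1"]
    proof eventually_elim
      case (elim r)
      then have "norm (r *\<^sub>R e) = r" using e by simp
      then show ?case
        using B[of "r *\<^sub>R e"] uf[of "r *\<^sub>R e"] elim by (simp add: field_simps)
    qed
  qed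
qed

lemma tendsto_at_infinity_radial:
  fixes u :: "'a::real_normed_vector \<Rightarrow> real"
  assumes "((\<lambda>r. f r / \<phi> r) \<longlongrightarrow> l) at_top" and "\<And>y. u y = f (norm y)"
  shows "((\<lambda>x. u x / \<phi> (norm x)) \<longlongrightarrow> l) at_infinity"
  using filterlim_compose[OF assms(1) filterlim_norm_at_top] by (simp add: assms(2))

lemma triharmonic_radial_rho_zero:
  fixes u :: "'a::euclidean_space \<Rightarrow> real" and F :: "nat \<Rightarrow> real \<Rightarrow> real" and q :: real
  assumes dim: "DIM('a) \<ge> 5" and q: "q > 5"
    and dF: "\<And>j r. j < 6 \<Longrightarrow> (F j has_real_derivative F (Suc j) r) (at r)"
    and F1: "F 1 0 = 0" and uF: "\<And>y. u y = F 0 (norm y)"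
    and eqn: "\<And>x. laplacian (laplacian (laplacian u)) x = u x powr (- q)"
    and growth: "Liminf at_infinity (\<lambda>x. ereal (u x / norm x)) > 0"
    and F2: "(F 2 \<longlongrightarrow> 0) at_top"
  shows "\<exists>I. ((\<lambda>t. t\<^sup>2 * (radial_lap DIM('a) (radial_lap DIM('a) (F 0)) t
            - (real DIM('a) - 3) / t * deriv (radial_lap DIM('a) (F 0)) t)) has_integral I) {0..}
        \<and> ((\<lambda>x. u x / norm x) \<longlongrightarrow> - I / (real DIM('a) - 1)) at_infinity
        \<and> 0 < - I / (real DIM('a) - 1)"
proof -
  obtain c where c: "c > 0" and grow: "\<forall>\<^sub>F r in at_top. c * r \<le> F 0 r"
    using liminf_ratio_pos_imp_linear_lower_bound[OF growth uF] by blast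
  obtain I where int: "((\<lambda>t. t\<^sup>2 * (radial_lap DIM('a) (radial_lap DIM('a) (F 0)) t
            - (real DIM('a) - 3) / t * deriv (radial_lap DIM('a) (F 0)) t)) has_integral I) {0..}"
    and lim: "((\<lambda>r. F 0 r / r) \<longlongrightarrow> - I / (real DIM('a) - 1)) at_top"
    using triharmonic_radial_linear_limit[OF dim q dF F1 uF eqn c grow F2] by blast
  have "c \<le> - I / (real DIM('a) - 1)"
  proof (rule tendsto_lowerbound[OF lim])
    show "\<forall>\<^sub>F r in at_top. c \<le> F 0 r / r"
      using grow eventually_gt_at_top[of 0] by eventually_elim (simp add: field_simps)
  qed simp
  then show ?thesis using int tendsto_at_infinity_radial[OF lim uF] c by auto
qed

theorem mainTheorem8:
  fixes u :: "'a::euclidean_space \<Rightarrow> real" and q \<rho> :: real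
  assumes dim: "DIM('a) \<ge> 5"
    and q: "q > 5"
    and reg: "Ck 6 u"
    and pos: "\<And>x. u x > 0"
    and radial: "\<And>x y. norm x = norm y \<Longrightarrow> u x = u y"
    and eqn: "\<And>x. laplacian (laplacian (laplacian u)) x = u x powr (- q)"
    and growth: "Liminf at_infinity (\<lambda>x. ereal (u x / norm x)) > 0"
    and rho: "((\<lambda>r. deriv (deriv (radial_profile u)) r) \<longlongrightarrow> \<rho>) at_top"
  shows "\<rho> \<ge> 0
    \<and> (\<rho> > 0 \<longrightarrow> ((\<lambda>x. u x / (norm x)\<^sup>2) \<longlongrightarrow> \<rho> / 2) at_infinity)
    \<and> (\<rho> = 0 \<longrightarrow>
        (let n = DIM('a); ub = radial_profile u;
             g = (\<lambda>t. t\<^sup>2 * (radial_lap n (radial_lap n ub) t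
                   - (real n - 3) / t * deriv (radial_lap n ub) t))
         in \<exists>I. (g has_integral I) {0..}
              \<and> ((\<lambda>x. u x / norm x) \<longlongrightarrow> - I / (real n - 1)) at_infinity
              \<and> 0 < - I / (real n - 1)))"
proof -
  obtain F where dF: "\<And>j r. j < 6 \<Longrightarrow> (F j has_real_derivative F (Suc j) r) (at r)"
    and ub: "F 0 = radial_profile u" and uF: "\<And>y. u y = F 0 (norm y)" and F1: "F 1 0 = 0"
    using radial_profile_derivs[OF reg radial] by blast
  have dF0: "(F 0 has_real_derivative F 1 r) (at r)" and dF1: "(F 1 has_real_derivative F 2 r) (at r)" for r
    using dF[of 0 r] dF[of 1 r] by (simp_all add: numeral_eq_Suc)
  have F2: "(F 2 \<longlongrightarrow> \<rho>) at_top"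
    using rho unfolding ub[symmetric] DERIV_imp_deriv[OF dF0] DERIV_imp_deriv[OF dF1]
    by (simp add: fun_eq_iff)
  have quad: "((\<lambda>r. F 0 r / r\<^sup>2) \<longlongrightarrow> \<rho> / 2) at_top"
    by (rule tendsto_div_square_of_second_deriv[OF dF0 dF1 F2])
  have "\<rho> / 2 \<ge> 0"
  proof (rule tendsto_lowerbound[OF quad])
    show "\<forall>\<^sub>F r in at_top. 0 \<le> F 0 r / r\<^sup>2"
      using pos by (simp add: ub radial_profile_def less_imp_le)
  qed simp
  then show ?thesis
    using tendsto_at_infinity_radial[OF quad uF] triharmonic_radial_rho_zero[OF dim q dF F1 uF eqn growth] F2
    unfolding Let_def ub by auto
qed

end
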